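(* Let $S \subset \mathbb{N}$ be a divisor stable and multiplicatively closed set and let $R$ be a $\mathbb{Z}_S$-algebra. Let $(\lambda^n_S)$ be the unique (special) $\lambda$-ring structure on $\mathbb{Z}_S R$ whose associated Adams operators $\psi^n_S : \mathbb{Z}_S R \to \mathbb{Z}_S R$ are determined by the formula $\psi^n_S [r] = [r]^{n_S}$ for $r \in R$. Then for every $n \ge 1$ and $x \in \mathbb{Z}_S R$ the following formula holds in $\mathbb{Z}_S R$: $$(-1)^n \lambda^n_S (x) = \sum_{\| \nu \| = n} (-1)^{|\nu|} \binom{\tau (x)}{\nu},$$ where the sum is over all $S$-tuples $\nu = (\nu_k)_{k\in S}$ of integers $\nu_k \ge 0$ with $\|\nu\| = \sum_{k\in S} k\nu_k = n$.
   Context: All rings are associative, commutative and unital; ring homomorphisms are unital. $\mathbb{N}$ denotes the positive integers. The set $S$ is divisor stable (every positive divisor of an element of $S$ lies in $S$) and multiplicatively closed, i.e. $S$ consists of all natural numbers whose prime divisors lie in a given set of prime numbers (so $1\in S$). Set $\mathbb{Z}_S = \mathbb{Z}[p^{-1} \mid p \text{ prime}, p \notin S]$. For $n \ge 1$ set $n_S = \prod_{p \in S,\ p \text{ prime}} p^{\mathrm{ord}_p(n)} \in S$. For a commutative ring $R$, $\mathbb{Z}R$ is the monoid algebra of the multiplicative monoid $(R,\cdot)$, with basis elements $[r]$, $r \in R$, and $\mathbb{Z}_S R = \mathbb{Z}R \otimes_{\mathbb{Z}} \mathbb{Z}_S$, regarded as a subring of $\mathbb{Z}R\otimes_{\mathbb{Z}}\mathbb{Q}$.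 The Adams operators $\psi^n$ of a $\lambda$-ring $(B,(\lambda^n))$ are given by $\sum_{n\ge 1} \psi^n(x) t^n = -t \frac{d}{dt} \log\big(\sum_{i \ge 0} (-1)^i \lambda^i(x) t^i\big)$. Existence and uniqueness of the special $\lambda$-ring structure on $\mathbb{Z}_S R$ follow from Wilkerson's lemma: if $B$ is a commutative ring without $\mathbb{Z}$-torsion with ring endomorphisms $\psi^n$ ($n\ge1$) such that $\psi^1 = \mathrm{id}$, $\psi^n\circ\psi^m = \psi^{nm}$, and $\psi^p(b) \equiv b^p \bmod pB$ for all $b\in B$ and all primes $p$, then there is a unique special $\lambda$-ring structure on $B$ with Adams operators $\psi^n$. Let $\mu$ be the Möbius function. For $x \in \mathbb{Z}_S R$ and $k \in S$ set $$\tau_k(x) = k^{-1} \sum_{d \mid k} \mu(d)\, \psi_S^{k/d}(x) \in \mathbb{Z}R\otimes_{\mathbb{Z}}\mathbb{Q}.$$ For an $S$-tuple $\nu = (\nu_k)_{k \in S}$ of integers $\nu_k \ge 0$ put $|\nu| = \sum_{k\in S} \nu_k$, $\|\nu\| = \sum_{k \in S} k\nu_k$, and $$\binom{\tau(x)}{\nu} = \prod_{k\in S} \binom{\tau_k(x)}{\nu_k} \in \mathbb{Z}R\otimes_{\mathbb{Z}}\mathbb{Q},$$ where $\binom{y}{j} = y(y-1)\cdots(y-j+1)/j!$. *)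

theory Defs
  imports
    "HOL-Library.Poly_Mapping"
    "HOL-Computational_Algebra.Computational_Algebra"
begin

section \<open>Subrings and the ring \<open>\<int>\<^sub>S\<close>\<close>

definition subring_of :: "'b::comm_ring_1 set \<Rightarrow> bool" where
  "subring_of B \<longleftrightarrow>
     1 \<in> B \<and> (\<forall>x\<in>B. \<forall>y\<in>B. x - y \<in> B) \<and> (\<forall>x\<in>B. \<forall>y\<in>B. x * y \<in> B)"

definition ZS :: "nat set \<Rightarrow> rat set" where
  "ZS S = subring_of hull {inverse (of_nat p) | p. prime p \<and> p \<notin> S}"

definition divisor_stable :: "nat set \<Rightarrow> bool" where
  "divisor_stable S \<longleftrightarrow> (\<forall>n\<in>S. \<forall>d. d dvd n \<longrightarrow> d \<in> S)"

definition mult_closed :: "nat set \<Rightarrow> bool" where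
  "mult_closed S \<longleftrightarrow> 1 \<in> S \<and> (\<forall>m\<in>S. \<forall>n\<in>S. m * n \<in> S)"

definition S_part :: "nat set \<Rightarrow> nat \<Rightarrow> nat" where
  "S_part S n = (\<Prod>p\<in>{p \<in> S. prime p \<and> p dvd n}. p ^ multiplicity p n)"

text \<open>
  A \<open>\<int>\<^sub>S\<close>-algebra is a commutative unital ring with a unital structure homomorphism
  \<open>h\<close> from \<open>\<int>\<^sub>S\<close>; the values of \<open>h\<close> outside \<open>\<int>\<^sub>S\<close> are irrelevant.
  The sort \<open>{comm_ring, comm_monoid_mult}\<close> is used instead of \<open>comm_ring_1\<close> because the latter
  excludes the zero ring.
\<close>

definition ZS_algebra ::
    "nat set \<Rightarrow> (rat \<Rightarrow> 'r::{comm_ring, comm_monoid_mult}) \<Rightarrow> bool" where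
  "ZS_algebra S h \<longleftrightarrow> h 1 = 1 \<and>
     (\<forall>a\<in>ZS S. \<forall>b\<in>ZS S. h (a + b) = h a + h b \<and> h (a * b) = h a * h b)"


section \<open>The monoid algebra of \<open>(R, \<cdot>)\<close>\<close>

text \<open>
  \<open>Poly_Mapping\<close> builds the monoid algebra of an \<^emph>\<open>additively\<close> written monoid.  The type
  \<open>'r mult_monoid\<close> is \<open>(R, \<cdot>)\<close> written additively.
\<close>

datatype 'r mult_monoid = Mult 'r

instantiation mult_monoid :: (comm_monoid_mult) comm_monoid_add
begin

definition zero_mult_monoid :: "'a mult_monoid" where
  "0 = Mult 1"

fun plus_mult_monoid :: "'a mult_monoid \<Rightarrow> 'a mult_monoid \<Rightarrow> 'a mult_monoid" where
  "Mult a + Mult b = Mult (a * b)"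

instance
proof
  fix a b c :: "'a mult_monoid"
  show "a + b + c = a + (b + c)"
    by (cases a; cases b; cases c) (simp add: mult.assoc)
  show "a + b = b + a"
    by (cases a; cases b) (simp add: mult.commute)
  show "0 + a = a"
    by (cases a) (simp add: zero_mult_monoid_def)
qed

end

text \<open>\<open>'r rat_monoid_algebra\<close> is \<open>\<int>R \<otimes> \<rat> = \<rat>R\<close>.\<close>

type_synonym 'r rat_monoid_algebra = "'r mult_monoid \<Rightarrow>\<^sub>0 rat"

definition bracket :: "'r::comm_monoid_mult \<Rightarrow> 'r rat_monoid_algebra" where
  "bracket r = Poly_Mapping.single (Mult r) 1"

definition ZSR :: "nat set \<Rightarrow> 'r::comm_monoid_mult rat_monoid_algebra set" where
  "ZSR S = {x. \<forall>m. Poly_Mapping.lookup x m \<in> ZS S}"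

definition scalar :: "rat \<Rightarrow> 'r::comm_monoid_mult rat_monoid_algebra" where
  "scalar c = Poly_Mapping.single 0 c"


section \<open>The universal polynomials of \<open>\<lambda>\<close>-ring theory\<close>

text \<open>Integer polynomials in finitely many of the variables \<open>X\<^sub>v\<close>, \<open>v :: 'v\<close>.\<close>

type_synonym 'v int_mpoly = "('v \<Rightarrow>\<^sub>0 nat) \<Rightarrow>\<^sub>0 int"

definition mvar :: "'v \<Rightarrow> 'v int_mpoly" where
  "mvar v = Poly_Mapping.single (Poly_Mapping.single v 1) 1"

definition mvars :: "'v int_mpoly \<Rightarrow> 'v set" where
  "mvars P = (\<Union>m\<in>Poly_Mapping.keys P. Poly_Mapping.keys m)"

definition meval :: "('v \<Rightarrow> 'b::comm_ring_1) \<Rightarrow> 'v int_mpoly \<Rightarrow> 'b" where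
  "meval a P = (\<Sum>m\<in>Poly_Mapping.keys P.
     of_int (Poly_Mapping.lookup P m) *
       (\<Prod>v\<in>Poly_Mapping.keys m. a v ^ Poly_Mapping.lookup m v))"

text \<open>
  \<open>esym I f k\<close> is the \<open>k\<close>-th elementary symmetric function of the finite family
  \<open>(f i)\<^bsub>i \<in> I\<^esub>\<close>, that is, the coefficient of \<open>t\<^sup>k\<close> in \<open>\<Prod>i\<in>I. (1 + f i * t)\<close>.
\<close>

definition esym :: "'i set \<Rightarrow> ('i \<Rightarrow> 'b::comm_ring_1) \<Rightarrow> nat \<Rightarrow> 'b" where
  "esym I f k = (\<Sum>A\<in>{A. A \<subseteq> I \<and> card A = k}. \<Prod>i\<in>A. f i)"

text \<open>
  \<open>P\<^sub>n(e\<^sub>1(x),\<dots>,e\<^sub>n(x); e\<^sub>1(y),\<dots>,e\<^sub>n(y))\<close> is the coefficient of \<open>t\<^sup>n\<close> in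
  \<open>\<Prod>\<^bsub>i,j \<le> n\<^esub> (1 + x\<^sub>i y\<^sub>j t)\<close>, as an identity in \<open>\<int>[x\<^sub>1,\<dots>,x\<^sub>n,y\<^sub>1,\<dots>,y\<^sub>n]\<close>.
  Here \<open>x\<^sub>i\<close> is the variable with index \<open>Inl i\<close> and \<open>y\<^sub>j\<close> the one with index \<open>Inr j\<close>; likewise
  \<open>P\<^sub>n\<close> itself is a polynomial in variables indexed by \<open>Inl i\<close> and \<open>Inr j\<close>, \<open>1 \<le> i, j \<le> n\<close>.
\<close>

definition lambda_prod_poly :: "nat \<Rightarrow> (nat + nat) int_mpoly" where
  "lambda_prod_poly n = (THE P.
     mvars P \<subseteq> Inl ` {1..n} \<union> Inr ` {1..n} \<and>
     meval (case_sum (esym {1..n} (\<lambda>i. mvar (Inl i))) (esym {1..n} (\<lambda>j. mvar (Inr j)))) P =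
       (esym ({1..n} \<times> {1..n}) (\<lambda>(i, j). mvar (Inl i) * mvar (Inr j)) n :: (nat + nat) int_mpoly))"

text \<open>
  \<open>P\<^bsub>m,n\<^esub>(e\<^sub>1(x),\<dots>,e\<^bsub>mn\<^esub>(x))\<close> is the coefficient of \<open>t\<^sup>m\<close> in
  \<open>\<Prod>\<^bsub>i\<^sub>1 < \<dots> < i\<^sub>n \<le> mn\<^esub> (1 + x\<^bsub>i\<^sub>1\<^esub> \<cdots> x\<^bsub>i\<^sub>n\<^esub> t)\<close>, as an identity in \<open>\<int>[x\<^sub>1,\<dots>,x\<^bsub>mn\<^esub>]\<close>.
\<close>

definition lambda_comp_poly :: "nat \<Rightarrow> nat \<Rightarrow> nat int_mpoly" where
  "lambda_comp_poly m n = (THE P.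
     mvars P \<subseteq> {1..m * n} \<and>
     meval (esym {1..m * n} mvar) P =
       (esym {A. A \<subseteq> {1..m * n} \<and> card A = n} (\<lambda>A. \<Prod>i\<in>A. mvar i) m :: nat int_mpoly))"


section \<open>Special \<open>\<lambda>\<close>-rings and Adams operators\<close>

text \<open>
  \<open>special_lambda_ring B \<lambda>\<close>: the operations \<open>\<lambda> n\<close> make the subring \<open>B\<close> of the ambient ring a
  special \<open>\<lambda>\<close>-ring.  The values of \<open>\<lambda> n\<close> outside \<open>B\<close> are irrelevant.
\<close>

definition special_lambda_ring :: "'b::comm_ring_1 set \<Rightarrow> (nat \<Rightarrow> 'b \<Rightarrow> 'b) \<Rightarrow> bool" where
  "special_lambda_ring B lam \<longleftrightarrow>
     subring_of B \<and>
     (\<forall>n. \<forall>x\<in>B. lam n x \<in> B) \<and>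
     (\<forall>x\<in>B. lam 0 x = 1) \<and>
     (\<forall>x\<in>B. lam 1 x = x) \<and>
     (\<forall>n. \<forall>x\<in>B. \<forall>y\<in>B. lam n (x + y) = (\<Sum>i\<le>n. lam i x * lam (n - i) y)) \<and>
     (\<forall>n\<ge>2. lam n 1 = 0) \<and>
     (\<forall>n\<ge>1. \<forall>x\<in>B. \<forall>y\<in>B. lam n (x * y) =
        meval (case_sum (\<lambda>i. lam i x) (\<lambda>j. lam j y)) (lambda_prod_poly n)) \<and>
     (\<forall>m\<ge>1. \<forall>n\<ge>1. \<forall>x\<in>B. lam m (lam n x) =
        meval (\<lambda>i. lam i x) (lambda_comp_poly m n))"

text \<open>
  \<open>\<Sum>\<^bsub>n\<ge>1\<^esub> \<psi>\<^sup>n(x) t\<^sup>n = - t d/dt log F(t)\<close> with \<open>F(t) = \<Sum>\<^bsub>i\<ge>0\<^esub> (-1)\<^sup>i \<lambda>\<^sup>i(x) t\<^sup>i\<close>.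
  The logarithmic derivative is \<open>F'(t) / F(t)\<close>; since \<open>F\<close> has constant coefficient \<open>1\<close>,
  \<open>1 / F(t)\<close> is the inverse power series with constant coefficient \<open>1\<close>
  (\<open>inverse\<close> on \<open>fps\<close> would need a division ring of coefficients).
\<close>

definition lambda_neg_series :: "(nat \<Rightarrow> 'b \<Rightarrow> 'b) \<Rightarrow> 'b \<Rightarrow> 'b::comm_ring_1 fps" where
  "lambda_neg_series lam x = Abs_fps (\<lambda>i. (-1) ^ i * lam i x)"

definition adams :: "(nat \<Rightarrow> 'b \<Rightarrow> 'b) \<Rightarrow> nat \<Rightarrow> 'b \<Rightarrow> 'b::comm_ring_1" where
  "adams lam n x =
     fps_nth (- fps_X * (fps_deriv (lambda_neg_series lam x) *
                         fps_left_inverse (lambda_neg_series lam x) 1)) n"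


section \<open>The elements \<open>\<tau>\<^sub>k(x)\<close> and their binomial coefficients\<close>

definition moebius :: "nat \<Rightarrow> int" where
  "moebius n = (if squarefree n then (-1) ^ card (prime_factors n) else 0)"

definition tau ::
    "(nat \<Rightarrow> 'r rat_monoid_algebra \<Rightarrow> 'r rat_monoid_algebra) \<Rightarrow> nat \<Rightarrow>
      'r rat_monoid_algebra \<Rightarrow> 'r::comm_monoid_mult rat_monoid_algebra" where
  "tau \<psi> k x = scalar (inverse (of_nat k)) *
     (\<Sum>d\<in>{d. d dvd k}. of_int (moebius d) * \<psi> (k div d) x)"

text \<open>\<open>gbinomial\<close> needs an integral domain of characteristic zero, which \<open>\<rat>R\<close> need not be.\<close>

definition binom ::
    "'r::comm_monoid_mult rat_monoid_algebra \<Rightarrow> nat \<Rightarrow> 'r rat_monoid_algebra" where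
  "binom y j = scalar (inverse (fact j)) * (\<Prod>i<j. y - of_nat i)"

text \<open>
  \<open>S\<close>-tuples \<open>\<nu>\<close> of non-negative integers are functions of finite support contained in \<open>S\<close>;
  for \<open>S \<subseteq> {1..}\<close>, the finiteness of the support is forced by \<open>\<parallel>\<nu>\<parallel> = n\<close>.
\<close>

definition tuple_abs :: "(nat \<Rightarrow>\<^sub>0 nat) \<Rightarrow> nat" where
  "tuple_abs \<nu> = (\<Sum>k\<in>Poly_Mapping.keys \<nu>. Poly_Mapping.lookup \<nu> k)"

definition tuple_norm :: "(nat \<Rightarrow>\<^sub>0 nat) \<Rightarrow> nat" where
  "tuple_norm \<nu> = (\<Sum>k\<in>Poly_Mapping.keys \<nu>. k * Poly_Mapping.lookup \<nu> k)"

definition tuples :: "nat set \<Rightarrow> nat \<Rightarrow> (nat \<Rightarrow>\<^sub>0 nat) set" where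
  "tuples S n = {\<nu>. Poly_Mapping.keys \<nu> \<subseteq> S \<and> tuple_norm \<nu> = n}"

definition multi_binom ::
    "(nat \<Rightarrow> 'r::comm_monoid_mult rat_monoid_algebra) \<Rightarrow> (nat \<Rightarrow>\<^sub>0 nat) \<Rightarrow>
      'r rat_monoid_algebra" where
  "multi_binom t \<nu> = (\<Prod>k\<in>Poly_Mapping.keys \<nu>. binom (t k) (Poly_Mapping.lookup \<nu> k))"

text \<open>The index set \<open>tuples S n\<close> is finite, so sums over it are not degenerate.\<close>

lemma finite_tuples:
  assumes "0 \<notin> S"
  shows "finite (tuples S n)"
proof -
  have "Poly_Mapping.lookup ` tuples S n \<subseteq>
      {f. (\<forall>k. (k \<in> {..n} \<longrightarrow> f k \<in> {..n}) \<and> (k \<notin> {..n} \<longrightarrow> f k = 0))}"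
  proof clarify
    fix \<nu> k assume nu: "\<nu> \<in> tuples S n"
    show "(k \<in> {..n} \<longrightarrow> Poly_Mapping.lookup \<nu> k \<in> {..n}) \<and>
          (k \<notin> {..n} \<longrightarrow> Poly_Mapping.lookup \<nu> k = 0)"
    proof (cases "k \<in> Poly_Mapping.keys \<nu>")
      case True
      have "k * Poly_Mapping.lookup \<nu> k \<le> tuple_norm \<nu>"
        unfolding tuple_norm_def using True by (intro member_le_sum) auto
      hence le: "k * Poly_Mapping.lookup \<nu> k \<le> n"
        using nu by (simp add: tuples_def)
      have "k \<in> S" using True nu by (auto simp: tuples_def)
      hence "k \<noteq> 0" using assms by metis
      hence pos: "k \<ge> 1" "Poly_Mapping.lookup \<nu> k \<ge> 1"
        using True by (simp_all add: in_keys_iff Suc_le_eq)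
      have "k * 1 \<le> k * Poly_Mapping.lookup \<nu> k"
        using pos(2) by (rule mult_le_mono2)
      moreover have "1 * Poly_Mapping.lookup \<nu> k \<le> k * Poly_Mapping.lookup \<nu> k"
        using pos(1) by (rule mult_le_mono1)
      ultimately have "k \<le> n" "Poly_Mapping.lookup \<nu> k \<le> n"
        using le by linarith+
      thus ?thesis by simp
    qed (simp add: in_keys_iff)
  qed
  moreover have "finite {f :: nat \<Rightarrow> nat.
      (\<forall>k. (k \<in> {..n} \<longrightarrow> f k \<in> {..n}) \<and> (k \<notin> {..n} \<longrightarrow> f k = 0))}"
    by (rule finite_set_of_finite_funs) auto
  ultimately have "finite (Poly_Mapping.lookup ` tuples S n)"
    by (rule finite_subset)
  thus ?thesis
    by (rule finite_imageD) (simp add: inj_on_def lookup_inject)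
qed

end

theory Submission
  imports Defs
begin

text \<open>
  Put \<open>F(t) = \<Sum> (-1)\<^sup>i \<lambda>\<^sup>i(x) t\<^sup>i\<close> and let \<open>\<theta> = t d/dt\<close>.  The definition of the Adams operators
  reads \<open>- \<theta>F = F \<cdot> \<Sum>\<^bsub>m\<ge>1\<^esub> \<psi>\<^sup>m(x) t\<^sup>m\<close> (\<open>adams_euler\<close>).  The right-hand side of the formula is the
  coefficient of \<open>t\<^sup>n\<close> in the formal product \<open>P(t) = \<Prod>\<^bsub>k\<in>S\<^esub> (1 - t\<^sup>k)\<close> with the \<open>k\<close>-th factor raised
  to the power \<open>\<tau>\<^sub>k(x)\<close> by the binomial series (\<open>dilated_prod_nth\<close>).  In the absence of torsion a power
  series is determined by its constant term and its logarithmic derivative (\<open>euler_unique\<close>), so it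
  suffices to compare the logarithmic derivatives of \<open>F\<close> and \<open>P\<close>.

  The factor for \<open>k\<close> contributes \<open>k \<tau>\<^sub>k(x) t\<^sup>k / (1 - t\<^sup>k)\<close> to \<open>- \<theta>P / P\<close>
  (\<open>euler_dilated_binomial_series\<close>).  Hence the coefficient of \<open>t\<^sup>m\<close> there is the sum of
  \<open>k \<tau>\<^sub>k(x)\<close> over all \<open>k \<in> S\<close> dividing \<open>m\<close>.  These \<open>k\<close> are exactly the divisors of the \<open>S\<close>-part
  \<open>m\<^sub>S\<close> (\<open>dvd_S_part_iff\<close>), and \<open>k \<tau>\<^sub>k(x) = \<Sum>\<^bsub>d|k\<^esub> \<mu>(d) \<psi>\<^bsup>k/d\<^esup>(x)\<close>, so Moebius inversion evaluates
  the sum to the Adams operator of index \<open>m\<^sub>S\<close> at \<open>x\<close>.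

  It remains to see that the Adams operators of indices \<open>m\<close> and \<open>m\<^sub>S\<close> agree on all of \<open>\<int>\<^sub>S R\<close>
  (\<open>adams_S_part\<close>).  They agree on the basis elements \<open>[r]\<close> because \<open>(m\<^sub>S)\<^sub>S = m\<^sub>S\<close>; both are additive
  because \<open>F\<^bsub>x+y\<^esub> = F\<^sub>x F\<^sub>y\<close>; and since \<open>\<rat>R\<close> has no torsion, denominators of the coefficients can be
  cleared.
\<close>


section \<open>Moebius inversion\<close>

lemma prod_primes_facts:
  fixes A :: "nat set"
  assumes "finite A" "\<And>p. p \<in> A \<Longrightarrow> prime p"
  shows "squarefree (\<Prod>A)" "prime_factors (\<Prod>A) = A"
proof -
  have "squarefree (\<Prod>p\<in>A. id p)"
    by (rule squarefree_prod_coprime) (use assms in \<open>auto intro: primes_coprime squarefree_prime\<close>)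
  thus "squarefree (\<Prod>A)" by simp
  have "0 \<notin> (\<lambda>p. p) ` A" using assms by force
  hence "prime_factors (\<Prod>p\<in>A. p) = (\<Union>p\<in>A. prime_factors p)"
    by (subst prime_factors_prod) (use assms in auto)
  also have "\<dots> = A" using assms by (auto simp: prime_prime_factors)
  finally show "prime_factors (\<Prod>A) = A" by simp
qed

lemma prod_prime_factors_squarefree:
  fixes d :: nat
  assumes "squarefree d"
  shows "\<Prod>(prime_factors d) = d"
proof -
  have "d \<noteq> 0" using assms by (metis not_squarefree_0)
  have "(\<Prod>p\<in>prime_factors d. p ^ multiplicity p d) = d"
    using prod_prime_factors[OF \<open>d \<noteq> 0\<close>] by simp
  moreover have "multiplicity p d = 1" if "p \<in> prime_factors d" for p
    using assms that \<open>d \<noteq> 0\<close>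
    by (auto simp: squarefree_factorial_semiring'' prime_factors_multiplicity intro!: le_antisym)
  ultimately show ?thesis by simp
qed

text \<open>
  Squarefree divisors of \<open>n\<close> correspond to sets of prime factors of \<open>n\<close>, and the alternating sum over
  all subsets of a set is the expansion of a product of factors \<open>1 - 1\<close>.
\<close>

lemma sum_moebius_divisors:
  fixes n :: nat
  assumes "n > 0"
  shows "(\<Sum>d | d dvd n. moebius d) = (if n = 1 then 1 else 0)"
proof -
  have "(\<Sum>d | d dvd n. moebius d) = (\<Sum>d | d dvd n \<and> squarefree d. (-1) ^ card (prime_factors d))"
    using assms by (intro sum.mono_neutral_cong_right) (auto simp: moebius_def)
  also have "\<dots> = (\<Sum>A\<in>Pow (prime_factors n). (-1) ^ card A)"
  proof (rule sum.reindex_bij_witness[where j = prime_factors and i = Prod])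
    fix A assume A: "A \<in> Pow (prime_factors n)"
    hence fin: "finite A" and pr: "\<And>p. p \<in> A \<Longrightarrow> prime p"
      by (auto intro: finite_subset)
    note * = prod_primes_facts[OF fin pr]
    have "\<Prod>A dvd (\<Prod>p\<in>prime_factors n. p ^ multiplicity p n)"
    proof -
      have "\<Prod>A dvd \<Prod>(prime_factors n)"
        using A by (intro prod_dvd_prod_subset) auto
      also have "\<dots> dvd (\<Prod>p\<in>prime_factors n. p ^ multiplicity p n)"
        by (intro prod_dvd_prod) (auto simp: dvd_power prime_factors_multiplicity)
      finally show ?thesis .
    qed
    hence "\<Prod>A dvd n" using prod_prime_factors[of n] assms by simp
    thus "\<Prod>A \<in> {d. d dvd n \<and> squarefree d}" using * by blast
    show "prime_factors (\<Prod>A) = A" by (rule *)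
  next
    fix d assume d: "d \<in> {d. d dvd n \<and> squarefree d}"
    thus "\<Prod>(prime_factors d) = d" using prod_prime_factors_squarefree by blast
    show "prime_factors d \<in> Pow (prime_factors n)"
      using d assms by (auto intro: dvd_prime_factors[THEN subsetD])
  qed auto
  also have "\<dots> = (\<Prod>p\<in>prime_factors n. 1 - 1)"
    using prod_diff_conv_sum[of "prime_factors n" "\<lambda>_. 1::int" "\<lambda>_. 1"] by simp
  also have "\<dots> = (if n = 1 then 1 else 0)"
    using assms by (auto simp: card_gt_0_iff prime_factorization_empty_iff)
  finally show ?thesis .
qed

text \<open>
  Writing \<open>k = e d\<close> and summing over \<open>d\<close> first, the coefficient of \<open>f e\<close> is the sum of \<open>\<mu>\<close> over the
  divisors of \<open>n / e\<close>, which vanishes unless \<open>e = n\<close>.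
\<close>

lemma moebius_inversion:
  fixes f :: "nat \<Rightarrow> 'b::comm_ring_1"
  assumes "n > 0"
  shows "(\<Sum>k | k dvd n. \<Sum>d | d dvd k. of_int (moebius d) * f (k div d)) = f n"
proof -
  have fin: "finite {d. d dvd m}" if "m dvd n" for m
    using that assms by (intro finite_divisors_nat) (auto intro: Nat.gr0I)
  have "(\<Sum>k | k dvd n. \<Sum>d | d dvd k. of_int (moebius d) * f (k div d)) =
        (\<Sum>(k, d)\<in>(SIGMA k:{k. k dvd n}. {d. d dvd k}). of_int (moebius d) * f (k div d))"
    using fin by (subst sum.Sigma) auto
  also have "\<dots> = (\<Sum>(e, d)\<in>(SIGMA e:{e. e dvd n}. {d. d dvd n div e}). of_int (moebius d) * f e)"
    by (rule sum.reindex_bij_witness[where i = "\<lambda>(e, d). (e * d, d)" and j = "\<lambda>(k, d). (k div d, d)"])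
       (use assms in \<open>auto elim!: dvdE\<close>)
  also have "\<dots> = (\<Sum>e | e dvd n. \<Sum>d | d dvd n div e. of_int (moebius d) * f e)"
    by (subst sum.Sigma) (use fin in \<open>auto simp: div_dvd_iff_mult intro!: fin dvd_div_iff_mult\<close>)
  also have "\<dots> = (\<Sum>e | e dvd n. of_int (\<Sum>d | d dvd n div e. moebius d) * f e)"
    by (simp add: sum_distrib_right)
  also have "\<dots> = (\<Sum>e | e dvd n. if e = n then f e else 0)"
  proof (rule sum.cong)
    fix e assume "e \<in> {e. e dvd n}"
    then obtain q where q: "n = e * q" by auto
    hence "e > 0" "q > 0" using assms by auto
    thus "of_int (\<Sum>d | d dvd n div e. moebius d) * f e = (if e = n then f e else 0)"
      using q by (auto simp: sum_moebius_divisors)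
  qed simp
  also have "\<dots> = f n" using fin[of n] by simp
  finally show ?thesis .
qed


section \<open>The \<open>S\<close>-part of an integer\<close>

lemma multiplicity_S_part:
  assumes "prime p" "m > 0"
  shows "multiplicity p (S_part S m) = (if p \<in> S then multiplicity p m else 0)"
proof -
  have "finite {p \<in> S. prime p \<and> p dvd m}"
    using assms by (intro finite_subset[OF _ finite_divisors_nat[of m]]) auto
  thus ?thesis unfolding S_part_def
    by (subst multiplicity_prod_prime_powers) (use assms in \<open>auto simp: not_dvd_imp_multiplicity_0\<close>)
qed

lemma S_part_pos: "S_part S m > 0"
  unfolding S_part_def by (intro prod_pos) (auto simp: prime_gt_0_nat)

lemma S_part_in:
  assumes "mult_closed S"
  shows "S_part S m \<in> S"
proof -
  have pow: "p ^ e \<in> S" if "p \<in> S" for p e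
    using that assms by (induction e) (auto simp: mult_closed_def)
  have "(\<Prod>p\<in>A. p ^ multiplicity p m) \<in> S" if "A \<subseteq> S" for A
    using that assms pow by (induction A rule: infinite_finite_induct) (auto simp: mult_closed_def)
  thus ?thesis unfolding S_part_def by auto
qed

text \<open>
  A divisor of \<open>m\<close> in \<open>S\<close> has all its prime divisors in \<open>S\<close> by divisor stability, and at primes in \<open>S\<close>
  the multiplicities in \<open>m\<close> and in its \<open>S\<close>-part agree.  Conversely the \<open>S\<close>-part, as a product of
  elements of \<open>S\<close>, lies in \<open>S\<close>, hence so do its divisors.
\<close>

lemma dvd_S_part_iff:
  assumes "divisor_stable S" "mult_closed S" "m > 0"
  shows "k dvd S_part S m \<longleftrightarrow> k \<in> S \<and> k dvd m"
proof (intro iffI conjI)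
  assume k: "k dvd S_part S m"
  show "k \<in> S" using k S_part_in[of S m] assms by (auto simp: divisor_stable_def)
  have "S_part S m dvd m"
    using assms S_part_pos[of S m] by (intro multiplicity_le_imp_dvd) (auto simp: multiplicity_S_part)
  thus "k dvd m" using k by (rule dvd_trans[rotated])
next
  assume k: "k \<in> S \<and> k dvd m"
  hence "k \<noteq> 0" using assms by auto
  show "k dvd S_part S m"
  proof (rule multiplicity_le_imp_dvd[OF \<open>k \<noteq> 0\<close>])
    fix p :: nat assume p: "prime p"
    show "multiplicity p k \<le> multiplicity p (S_part S m)"
    proof (cases "p dvd k")
      case True
      hence "p \<in> S" using k assms by (auto simp: divisor_stable_def)
      thus ?thesis using k p assms by (simp add: multiplicity_S_part dvd_imp_multiplicity_le)
    qed (simp add: not_dvd_imp_multiplicity_0)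
  qed
qed

lemma S_part_idem:
  assumes "divisor_stable S" "mult_closed S" "m > 0"
  shows "S_part S (S_part S m) = S_part S m"
  using dvd_S_part_iff[OF assms] dvd_S_part_iff[OF assms(1,2) S_part_pos] S_part_in[OF assms(2)]
  by (metis dvd_antisym dvd_refl)


section \<open>Power series determined by their logarithmic derivative\<close>

text \<open>
  The series \<open>\<Sum> c\<^sub>j t\<^bsup>kj\<^esup>\<close>, for \<open>k > 0\<close>.
\<close>

definition dilated_series :: "nat \<Rightarrow> (nat \<Rightarrow> 'b::comm_ring_1) \<Rightarrow> 'b fps" where
  "dilated_series k c = Abs_fps (\<lambda>m. if k dvd m then c (m div k) else 0)"

lemma euler_nth: "(fps_X * fps_deriv f) $ m = of_nat m * (f $ m)" for f :: "'b::comm_ring_1 fps"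
  by (cases m) auto

text \<open>
  Comparing coefficients in \<open>\<theta>F = F L\<close> gives \<open>m F\<^sub>m = \<Sum>\<^bsub>i<m\<^esub> F\<^sub>i L\<^bsub>m-i\<^esub>\<close>, a recursion that determines
  \<open>F\<^sub>m\<close> as \<open>m\<close> is not a zero divisor.  The version truncated at \<open>n\<close> allows the infinite product over
  \<open>S\<close> to be replaced by the finite product over its elements up to \<open>n\<close>.
\<close>

lemma euler_unique:
  fixes F G L M :: "'b::comm_ring_1 fps"
  assumes torsion_free: "\<And>m (y::'b). m > 0 \<Longrightarrow> of_nat m * y = 0 \<Longrightarrow> y = 0"
    and "F $ 0 = G $ 0"
    and F: "fps_X * fps_deriv F = F * L" and G: "fps_X * fps_deriv G = G * M"
    and "L $ 0 = 0" and LM: "\<And>m. m \<le> n \<Longrightarrow> L $ m = M $ m"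
    and "m \<le> n"
  shows "F $ m = G $ m"
  using \<open>m \<le> n\<close>
proof (induction m rule: less_induct)
  case (less m)
  show ?case
  proof (cases "m = 0")
    case False
    have M0: "M $ 0 = 0" using LM[of 0] \<open>L $ 0 = 0\<close> by simp
    have "of_nat m * F $ m = (\<Sum>i=0..m. F $ i * L $ (m - i))"
      using euler_nth[of F m] unfolding F fps_mult_nth by (rule sym)
    also have "\<dots> = (\<Sum>i=0..m. G $ i * M $ (m - i))"
    proof (rule sum.cong)
      fix i assume "i \<in> {0..m}"
      thus "F $ i * L $ (m - i) = G $ i * M $ (m - i)"
        using less LM[of "m - i"] M0 \<open>L $ 0 = 0\<close> by (cases "i = m") auto
    qed simp
    also have "\<dots> = of_nat m * G $ m"
      using euler_nth[of G m] unfolding G fps_mult_nth .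
    finally have "of_nat m * (F $ m - G $ m) = 0" by (simp add: algebra_simps)
    hence "F $ m - G $ m = 0" using torsion_free[of m "F $ m - G $ m"] False by blast
    thus ?thesis by simp
  qed (use assms in simp)
qed

text \<open>
  The logarithmic derivative turns products into sums.
\<close>

lemma euler_prod:
  fixes B L :: "'i \<Rightarrow> 'b::comm_ring_1 fps"
  assumes "\<And>k. k \<in> K \<Longrightarrow> fps_X * fps_deriv (B k) = B k * L k"
  shows "fps_X * fps_deriv (\<Prod>k\<in>K. B k) = (\<Prod>k\<in>K. B k) * (\<Sum>k\<in>K. L k)"
  using assms
proof (induction K rule: infinite_finite_induct)
  case (insert k K)
  have "fps_X * fps_deriv (\<Prod>k\<in>insert k K. B k) =
      (fps_X * fps_deriv (B k)) * (\<Prod>k\<in>K. B k) + B k * (fps_X * fps_deriv (\<Prod>k\<in>K. B k))"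
    using insert.hyps by (simp add: algebra_simps)
  also have "\<dots> = (\<Prod>k\<in>insert k K. B k) * (\<Sum>k\<in>insert k K. L k)"
    using insert by (simp add: algebra_simps)
  finally show ?case .
qed auto

lemma one_minus_X_power_cancel:
  fixes f g :: "'b::comm_ring_1 fps"
  assumes "k > 0" "(1 - fps_X ^ k) * f = (1 - fps_X ^ k) * g"
  shows "f = g"
proof -
  have "fps_left_inverse (1 - fps_X ^ k) 1 * (1 - fps_X ^ k) = (1 :: 'b fps)"
    using assms(1) by (intro fps_left_inverse) (simp add: fps_X_power_nth)
  thus ?thesis using assms(2) by (metis mult.assoc mult_1)
qed

text \<open>
  The recursion for \<open>c\<close> is that of the signed binomial coefficients \<open>(-1)\<^sup>j (y choose j)\<close>, so the series
  is formally, up to the factor \<open>c 0\<close>, the \<open>y\<close>-th power of \<open>1 - t\<^sup>k\<close>, with logarithmic derivative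
  \<open>- k y t\<^sup>k / (1 - t\<^sup>k)\<close>.  The denominator is cleared before coefficients are compared; the coefficient
  of \<open>t\<^bsup>k(j+1)\<^esup>\<close> then is the given recursion.
\<close>

lemma euler_dilated_binomial_series:
  fixes y :: "'b::comm_ring_1"
  assumes "k > 0" and c: "\<And>j. of_nat (Suc j) * c (Suc j) = - (y - of_nat j) * c j"
  shows "fps_X * fps_deriv (dilated_series k c) =
    dilated_series k c * Abs_fps (\<lambda>m. if m > 0 \<and> k dvd m then - (of_nat k * y) else 0)"
    (is "_ = ?B * ?L")
proof (rule one_minus_X_power_cancel[OF \<open>k > 0\<close>])
  \<comment> \<open>The geometric series \<open>?L = - k y (t\<^sup>k + t\<^bsup>2k\<^esup> + \<dots>)\<close> telescopes.\<close>
  have L: "(1 - fps_X ^ k) * ?L = fps_X ^ k * fps_const (- (of_nat k * y))"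
  proof (rule fps_ext)
    fix m
    show "((1 - fps_X ^ k) * ?L) $ m = (fps_X ^ k * fps_const (- (of_nat k * y))) $ m"
      using \<open>k > 0\<close> by (auto simp: left_diff_distrib fps_X_power_mult_nth dvd_minus_self
        intro: dvd_imp_le elim: dvdE)
  qed
  have "(1 - fps_X ^ k) * (fps_X * fps_deriv ?B) = fps_X ^ k * (fps_const (- (of_nat k * y)) * ?B)"
  proof (rule fps_ext)
    fix m
    consider "\<not> k dvd m" | "m = 0" | j where "m = k * Suc j"
      by (metis dvdE mult_0_right not0_implies_Suc)
    thus "((1 - fps_X ^ k) * (fps_X * fps_deriv ?B)) $ m =
          (fps_X ^ k * (fps_const (- (of_nat k * y)) * ?B)) $ m"
    proof cases
      case 3
      have "of_nat m * c (Suc j) - of_nat (m - k) * c j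
            = of_nat k * (of_nat (Suc j) * c (Suc j) - of_nat j * c j)"
        using 3 by (simp add: algebra_simps)
      also have "\<dots> = - (of_nat k * y) * c j"
        by (subst c) (simp add: algebra_simps)
      finally show ?thesis
        using 3 \<open>k > 0\<close>
        by (simp only: left_diff_distrib mult_1 fps_sub_nth fps_X_power_mult_nth euler_nth)
           (simp add: dilated_series_def)
    qed (use \<open>k > 0\<close> in \<open>auto simp: left_diff_distrib fps_X_power_mult_nth euler_nth
         dilated_series_def dvd_minus_self simp del: fps_X_mult_nth fps_deriv_nth\<close>)
  qed
  also have "\<dots> = (1 - fps_X ^ k) * (?B * ?L)"
    using arg_cong[OF L, of "\<lambda>f. f * ?B"] by (simp add: mult_ac)
  finally show "(1 - fps_X ^ k) * (fps_X * fps_deriv ?B) = (1 - fps_X ^ k) * (?B * ?L)" .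
qed


section \<open>Coefficients of products of dilated series\<close>

lemma tuple_norm_superset:
  assumes "finite K" "Poly_Mapping.keys \<nu> \<subseteq> K"
  shows "tuple_norm \<nu> = (\<Sum>k\<in>K. k * Poly_Mapping.lookup \<nu> k)"
  unfolding tuple_norm_def using assms
  by (intro sum.mono_neutral_left) (auto simp: in_keys_iff)

text \<open>
  Expanding the product, choosing the term \<open>c k (\<nu> k) t\<^bsup>k \<nu> k\<^esup>\<close> from the \<open>k\<close>-th factor gives the exponent
  \<open>\<parallel>\<nu>\<parallel>\<close>.  In the induction step a tuple on \<open>insert a K\<close> is split into the exponent \<open>i = a \<cdot> \<nu> a\<close> and its
  restriction to \<open>K\<close>.
\<close>

lemma dilated_prod_nth:
  fixes c :: "nat \<Rightarrow> nat \<Rightarrow> 'b::comm_ring_1"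
  assumes "finite K" "0 \<notin> K"
  shows "(\<Prod>k\<in>K. dilated_series k (c k)) $ n =
    (\<Sum>\<nu>\<in>tuples K n. \<Prod>k\<in>K. c k (Poly_Mapping.lookup \<nu> k))"
  using assms
proof (induction K arbitrary: n rule: finite_induct)
  case empty
  have "tuples {} n = (if n = 0 then {0} else {})"
    by (auto simp: tuples_def tuple_norm_def)
  thus ?case by simp
next
  case (insert a K)
  have "a > 0" "0 \<notin> K" using insert by auto
  let ?I = "{i. i \<le> n \<and> a dvd i}"
  have "(\<Prod>k\<in>insert a K. dilated_series k (c k)) $ n =
      (\<Sum>i=0..n. dilated_series a (c a) $ i *
         (\<Sum>\<nu>\<in>tuples K (n - i). \<Prod>k\<in>K. c k (Poly_Mapping.lookup \<nu> k)))"
    using insert by (simp add: fps_mult_nth)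
  also have "\<dots> = (\<Sum>i\<in>?I. c a (i div a) *
         (\<Sum>\<nu>\<in>tuples K (n - i). \<Prod>k\<in>K. c k (Poly_Mapping.lookup \<nu> k)))"
    by (intro sum.mono_neutral_cong_right) (auto simp: dilated_series_def)
  also have "\<dots> = (\<Sum>(i, \<nu>)\<in>(SIGMA i:?I. tuples K (n - i)).
      c a (i div a) * (\<Prod>k\<in>K. c k (Poly_Mapping.lookup \<nu> k)))"
    using finite_tuples[OF \<open>0 \<notin> K\<close>] by (simp add: sum_distrib_left sum.Sigma)
  also have "\<dots> = (\<Sum>\<nu>\<in>tuples (insert a K) n. \<Prod>k\<in>insert a K. c k (Poly_Mapping.lookup \<nu> k))"
  proof (rule sum.reindex_bij_witness[where
        i = "\<lambda>\<nu>. (a * Poly_Mapping.lookup \<nu> a, Poly_Mapping.update a 0 \<nu>)" and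
        j = "\<lambda>(i, \<nu>). Poly_Mapping.update a (i div a) \<nu>"], goal_cases)
    case (1 p)
    obtain i \<nu> where p: "p = (i, \<nu>)" by (cases p)
    have "a \<notin> Poly_Mapping.keys \<nu>" using 1 p insert by (auto simp: tuples_def)
    thus ?case using 1 p \<open>a > 0\<close>
      by (auto simp: lookup_update in_keys_iff intro!: poly_mapping_eqI)
  next
    case (2 p)
    obtain i \<nu> where p: "p = (i, \<nu>)" by (cases p)
    have keys: "Poly_Mapping.keys \<nu> \<subseteq> K" and i: "i \<le> n" "a dvd i" and nu: "tuple_norm \<nu> = n - i"
      using 2 p by (auto simp: tuples_def)
    let ?\<nu> = "Poly_Mapping.update a (i div a) \<nu>"
    have keys': "Poly_Mapping.keys ?\<nu> \<subseteq> insert a K"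
      using keys by (auto simp: keys_update)
    have "tuple_norm ?\<nu> = i + (\<Sum>k\<in>K. k * Poly_Mapping.lookup ?\<nu> k)"
      using insert i by (subst tuple_norm_superset[OF _ keys']) (auto simp: lookup_update)
    also have "(\<Sum>k\<in>K. k * Poly_Mapping.lookup ?\<nu> k) = (\<Sum>k\<in>K. k * Poly_Mapping.lookup \<nu> k)"
      using insert by (intro sum.cong) (auto simp: lookup_update)
    also have "\<dots> = n - i" using nu tuple_norm_superset[OF \<open>finite K\<close> keys] by simp
    finally show ?case using keys' i p by (simp add: tuples_def)
  next
    case (3 \<nu>)
    thus ?case using \<open>a > 0\<close> by (auto simp: lookup_update intro!: poly_mapping_eqI)
  next
    case (4 \<nu>)
    have keys: "Poly_Mapping.keys \<nu> \<subseteq> insert a K" and nu: "tuple_norm \<nu> = n"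
      using 4 by (auto simp: tuples_def)
    let ?\<nu> = "Poly_Mapping.update a 0 \<nu>"
    have keys': "Poly_Mapping.keys ?\<nu> \<subseteq> K" using keys by (auto simp: keys_update)
    have "n = a * Poly_Mapping.lookup \<nu> a + (\<Sum>k\<in>K. k * Poly_Mapping.lookup \<nu> k)"
      using insert tuple_norm_superset[OF _ keys] nu by simp
    moreover have "tuple_norm ?\<nu> = (\<Sum>k\<in>K. k * Poly_Mapping.lookup \<nu> k)"
      using insert by (subst tuple_norm_superset[OF _ keys']) (auto simp: lookup_update intro!: sum.cong)
    ultimately show ?case using keys' by (simp add: tuples_def)
  next
    case (5 p)
    obtain i \<nu> where p: "p = (i, \<nu>)" by (cases p)
    have "(\<Prod>k\<in>K. c k (Poly_Mapping.lookup (Poly_Mapping.update a (i div a) \<nu>) k)) =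
          (\<Prod>k\<in>K. c k (Poly_Mapping.lookup \<nu> k))"
      using insert by (intro prod.cong) (auto simp: lookup_update)
    thus ?case using p insert by (simp add: lookup_update)
  qed
  finally show ?case .
qed


section \<open>Scalars and binomial coefficients in \<open>\<rat>R\<close>\<close>

lemma scalar_mult: "scalar a * scalar b = scalar (a * b)"
  by (simp add: scalar_def mult_single)

lemma of_nat_eq_scalar: "of_nat n = scalar (of_nat n)"
  by (simp add: scalar_def)

lemma scalar_1: "scalar 1 = 1"
  by (simp add: scalar_def)

lemma rat_monoid_algebra_torsion_free:
  fixes y :: "'r::comm_monoid_mult rat_monoid_algebra"
  assumes "m > 0" "of_nat m * y = 0"
  shows "y = 0"
proof -
  have "y = scalar (inverse (of_nat m)) * (of_nat m * y)"
    unfolding of_nat_eq_scalar mult.assoc[symmetric] scalar_mult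
    using assms(1) by (simp add: scalar_1)
  thus ?thesis using assms(2) by simp
qed

lemma of_nat_mult_tau:
  assumes "k > 0"
  shows "of_nat k * tau \<psi> k x = (\<Sum>d | d dvd k. of_int (moebius d) * \<psi> (k div d) x)"
  unfolding tau_def of_nat_eq_scalar mult.assoc[symmetric] scalar_mult
  using assms by (simp add: scalar_1)

lemma binom_0: "binom y 0 = 1"
  by (simp add: binom_def scalar_1)

lemma binom_Suc: "of_nat (Suc j) * binom y (Suc j) = (y - of_nat j) * binom y j"
proof -
  have *: "of_nat (Suc j) * scalar (inverse (fact (Suc j))) = scalar (inverse (fact j))"
    unfolding of_nat_eq_scalar scalar_mult fact_Suc of_nat_mult inverse_mult_distrib mult.assoc[symmetric]
    by (simp del: of_nat_Suc)
  show ?thesis unfolding binom_def prod.lessThan_Suc mult.assoc[symmetric] *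
    by (simp only: mult_ac)
qed

lemma signed_multi_binom:
  assumes "finite K" "Poly_Mapping.keys \<nu> \<subseteq> K"
  shows "(-1) ^ tuple_abs \<nu> * multi_binom t \<nu> =
    (\<Prod>k\<in>K. (-1) ^ Poly_Mapping.lookup \<nu> k * binom (t k) (Poly_Mapping.lookup \<nu> k))"
proof -
  have "(-1) ^ tuple_abs \<nu> * multi_binom t \<nu> =
     (\<Prod>k\<in>Poly_Mapping.keys \<nu>. (-1) ^ Poly_Mapping.lookup \<nu> k * binom (t k) (Poly_Mapping.lookup \<nu> k))"
    by (simp add: tuple_abs_def multi_binom_def power_sum prod.distrib)
  also have "\<dots> = (\<Prod>k\<in>K. (-1) ^ Poly_Mapping.lookup \<nu> k * binom (t k) (Poly_Mapping.lookup \<nu> k))"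
    using assms by (intro prod.mono_neutral_left) (auto simp: in_keys_iff binom_0)
  finally show ?thesis .
qed


section \<open>Additivity of the Adams operators\<close>

lemma adams_euler:
  fixes lam :: "nat \<Rightarrow> 'b \<Rightarrow> 'b::comm_ring_1"
  assumes "lam 0 x = 1"
  shows "fps_X * fps_deriv (lambda_neg_series lam x) =
    lambda_neg_series lam x * - Abs_fps (\<lambda>m. adams lam m x)"
proof -
  let ?F = "lambda_neg_series lam x"
  have "fps_left_inverse ?F 1 * ?F = 1"
    by (rule fps_left_inverse) (use assms in \<open>simp add: lambda_neg_series_def\<close>)
  moreover have "Abs_fps (\<lambda>m. adams lam m x) = - fps_X * (fps_deriv ?F * fps_left_inverse ?F 1)"
    by (simp add: adams_def fps_eq_iff)
  ultimately show ?thesis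
    by (simp add: mult.assoc mult.left_commute[of ?F]) (simp add: mult.commute)
qed

text \<open>
  The addition formula for \<open>\<lambda>\<close> says that \<open>F\<^bsub>x+y\<^esub> = F\<^sub>x F\<^sub>y\<close>, and the Adams operators are the
  coefficients of a logarithmic derivative.
\<close>

lemma adams_add:
  fixes lam :: "nat \<Rightarrow> 'b \<Rightarrow> 'b::comm_ring_1"
  assumes x: "lam 0 x = 1" and y: "lam 0 y = 1" and xy: "lam 0 (x + y) = 1"
    and add: "\<And>n. lam n (x + y) = (\<Sum>i\<le>n. lam i x * lam (n - i) y)"
  shows "adams lam m (x + y) = adams lam m x + adams lam m y"
proof -
  let ?F = "lambda_neg_series lam" and ?A = "\<lambda>x. Abs_fps (\<lambda>m. adams lam m x)"
  have F: "?F (x + y) = ?F x * ?F y"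
  proof (rule fps_ext)
    fix n
    have "(-1) ^ n * (lam i x * lam (n - i) y) = (-1) ^ i * lam i x * ((-1) ^ (n - i) * lam (n - i) y)"
      if "i \<le> n" for i
    proof -
      have "(-1::'b) ^ n = (-1) ^ i * (-1) ^ (n - i)" using that by (simp flip: power_add)
      thus ?thesis by (simp add: mult_ac)
    qed
    thus "?F (x + y) $ n = (?F x * ?F y) $ n"
      by (simp add: lambda_neg_series_def fps_mult_nth add sum_distrib_left atMost_atLeast0)
  qed
  let ?G = "fps_left_inverse (?F (x + y)) 1"
  have inv: "?G * ?F (x + y) = 1"
    by (rule fps_left_inverse) (use xy in \<open>simp add: lambda_neg_series_def\<close>)
  have "?F (x + y) * - ?A (x + y) = fps_X * fps_deriv (?F x * ?F y)"
    using adams_euler[of lam, OF xy] by (simp only: F)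
  also have "\<dots> = (fps_X * fps_deriv (?F x)) * ?F y + ?F x * (fps_X * fps_deriv (?F y))"
    by (simp add: algebra_simps)
  also have "\<dots> = ?F (x + y) * - (?A x + ?A y)"
    unfolding adams_euler[of lam, OF x] adams_euler[of lam, OF y] F by (simp add: algebra_simps)
  finally have "?F (x + y) * ?A (x + y) = ?F (x + y) * (?A x + ?A y)"
    by (simp only: mult_minus_right neg_equal_iff_equal)
  hence "?G * ?F (x + y) * ?A (x + y) = ?G * ?F (x + y) * (?A x + ?A y)"
    by (simp only: mult.assoc)
  hence "?A (x + y) = ?A x + ?A y" by (simp only: inv mult_1)
  from arg_cong[OF this, of "\<lambda>f. f $ m"] show ?thesis by simp
qed

text \<open>
  If \<open>c = a / b\<close>, then \<open>b D(c [r]) = D(a [r]) = a D([r]) = 0\<close>, and \<open>b\<close> can be cancelled.  Applied to the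
  difference of two additive maps, this shows that an additive map on \<open>\<int>\<^sub>S R\<close> with values in \<open>\<rat>R\<close> is
  determined by its values on the \<open>[r]\<close>.
\<close>

lemma additive_vanishes_on_ZSR:
  fixes D :: "'r::comm_monoid_mult rat_monoid_algebra \<Rightarrow> 'r rat_monoid_algebra"
  assumes sub: "subring_of (ZSR S :: 'r rat_monoid_algebra set)"
    and add: "\<And>x y. x \<in> ZSR S \<Longrightarrow> y \<in> ZSR S \<Longrightarrow> D (x + y) = D x + D y"
    and bracket: "\<And>r. D (bracket r) = 0"
    and "x \<in> ZSR S"
  shows "D x = 0"
proof -
  let ?B = "ZSR S :: 'r rat_monoid_algebra set"
  have diff: "x - y \<in> ?B" if "x \<in> ?B" "y \<in> ?B" for x y
    using sub that by (auto simp: subring_of_def)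
  have one: "1 \<in> ?B" using sub by (auto simp: subring_of_def)
  have zero: "0 \<in> ?B" using diff[OF one one] by simp
  have plus: "x + y \<in> ?B" if "x \<in> ?B" "y \<in> ?B" for x y
    using diff[OF that(1) diff[OF zero that(2)]] by simp
  have D0: "D 0 = 0" using add[OF zero zero] by simp
  have nat_mult: "of_nat n * y \<in> ?B \<and> D (of_nat n * y) = of_nat n * D y" if "y \<in> ?B" for n y
    by (induction n) (use that zero D0 plus add in \<open>auto simp: algebra_simps\<close>)
  have neg: "D (- y) = - D y" if "y \<in> ?B" for y
    using add[OF that diff[OF zero that]] D0 by (simp add: eq_neg_iff_add_eq_0 add.commute)
  have int_mult: "D (of_int a * y) = of_int a * D y" if "y \<in> ?B" for a y
    using that nat_mult neg by (cases a rule: int_cases2) auto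
  have "0 \<in> ZS S" using zero by (auto simp: ZSR_def)
  have "1 \<in> ZS S"
    using one by (metis (mono_tags) ZSR_def lookup_one_zero mem_Collect_eq)
  have single: "Poly_Mapping.single m c \<in> ?B" if "c \<in> ZS S" for m c
    using that \<open>0 \<in> ZS S\<close> by (auto simp: ZSR_def lookup_single when_def)
  have single_0: "D (Poly_Mapping.single m c) = 0" if c: "c \<in> ZS S" for m c
  proof -
    obtain r where m: "m = Mult r" by (cases m)
    obtain a b where ab: "c = of_int a / of_int b" "b > 0"
      by (metis quotient_of_div quotient_of_denom_pos surj_pair)
    define n where "n = nat b"
    have n: "n > 0" "of_nat n * c = of_int a" using ab by (auto simp: n_def)
    have "of_nat n * Poly_Mapping.single m c = of_int a * bracket r"
      using n(2) unfolding bracket_def m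
      by (simp add: mult_single flip: single_of_nat single_of_int)
    moreover have "bracket r \<in> ?B"
      unfolding bracket_def by (rule single[OF \<open>1 \<in> ZS S\<close>])
    ultimately have "of_nat n * D (Poly_Mapping.single m c) = 0"
      using nat_mult[OF single[OF c]] int_mult bracket by (metis mult_zero_right)
    thus ?thesis using n(1) rat_monoid_algebra_torsion_free by blast
  qed
  have coeff: "Poly_Mapping.lookup x m \<in> ZS S" for m using \<open>x \<in> ZSR S\<close> by (simp add: ZSR_def)
  define mon where "mon m = Poly_Mapping.single m (Poly_Mapping.lookup x m)" for m
  have "(\<Sum>m\<in>M. mon m) \<in> ?B \<and> D (\<Sum>m\<in>M. mon m) = 0" for M
    by (induction M rule: infinite_finite_induct)
       (use zero D0 plus add single[OF coeff] single_0[OF coeff] in \<open>auto simp: mon_def\<close>)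
  moreover have "x = (\<Sum>m\<in>Poly_Mapping.keys x. mon m)"
    by (rule poly_mapping_eqI)
       (auto simp: mon_def lookup_sum lookup_single when_def in_keys_iff sum.delta)
  ultimately show ?thesis by metis
qed

text \<open>
  Both sides are additive in \<open>x\<close>, and on \<open>[r]\<close> both equal \<open>[r]\<close> raised to the \<open>S\<close>-part of \<open>m\<close>, since
  taking the \<open>S\<close>-part is idempotent.
\<close>

lemma adams_S_part:
  fixes lam :: "nat \<Rightarrow> 'r rat_monoid_algebra \<Rightarrow> 'r::comm_monoid_mult rat_monoid_algebra"
  assumes S: "divisor_stable S" "mult_closed S"
    and lam: "special_lambda_ring (ZSR S) lam"
    and bracket: "\<And>m r. m \<ge> 1 \<Longrightarrow> adams lam m (bracket r) = bracket r ^ S_part S m"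
    and "m \<ge> 1" "x \<in> ZSR S"
  shows "adams lam (S_part S m) x = adams lam m x"
proof -
  let ?B = "ZSR S :: 'r rat_monoid_algebra set"
  have sub: "subring_of ?B" using lam by (simp add: special_lambda_ring_def)
  have plus: "x + y \<in> ?B" if "x \<in> ?B" "y \<in> ?B" for x y
    using sub that unfolding subring_of_def by (metis diff_0 diff_minus_eq_add diff_self)
  have add: "adams lam m (x + y) = adams lam m x + adams lam m y" if "x \<in> ?B" "y \<in> ?B" for m x y
    using lam that plus by (intro adams_add) (auto simp: special_lambda_ring_def)
  have "adams lam (S_part S m) x - adams lam m x = 0"
  proof (rule additive_vanishes_on_ZSR[OF sub _ _ \<open>x \<in> ZSR S\<close>])
    fix r
    have "S_part S m \<ge> 1" using S_part_pos[of S m] by simp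
    thus "adams lam (S_part S m) (bracket r) - adams lam m (bracket r) = 0"
      using \<open>m \<ge> 1\<close> S by (simp add: bracket S_part_idem)
  qed (simp add: add)
  thus ?thesis by simp
qed


section \<open>The formula for \<open>\<lambda>\<^sub>S\<close>\<close>

theorem theorem1p3:
  fixes S :: "nat set"
    and h :: "rat \<Rightarrow> 'r::{comm_ring, comm_monoid_mult}"
    and lam :: "nat \<Rightarrow> 'r rat_monoid_algebra \<Rightarrow> 'r rat_monoid_algebra"
    and n :: nat
    and x :: "'r rat_monoid_algebra"
  assumes "0 \<notin> S" and "divisor_stable S" and "mult_closed S"
    and "ZS_algebra S h"
    and "special_lambda_ring (ZSR S) lam"
    and "\<And>m r. m \<ge> 1 \<Longrightarrow> adams lam m (bracket r) = bracket r ^ S_part S m"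
    and "n \<ge> 1"
    and "x \<in> ZSR S"
  shows "(-1) ^ n * lam n x =
    (\<Sum>\<nu>\<in>tuples S n. (-1) ^ tuple_abs \<nu> * multi_binom (\<lambda>k. tau (adams lam) k x) \<nu>)"
proof -
  define t where "t k = tau (adams lam) k x" for k
  define K where "K = {k \<in> S. k \<le> n}"
  define c where "c k j = (-1) ^ j * binom (t k) j" for k j
  define L where "L k = Abs_fps (\<lambda>m. if m > 0 \<and> k dvd m then - (of_nat k * t k) else 0)" for k
  define F where "F = lambda_neg_series lam x"
  define P where "P = (\<Prod>k\<in>K. dilated_series k (c k))"
  have K: "finite K" "0 \<notin> K" "\<And>k. k \<in> K \<Longrightarrow> k > 0"
    using \<open>0 \<notin> S\<close> by (auto simp: K_def intro: Nat.gr0I)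
  have lam0: "lam 0 x = 1" using assms by (simp add: special_lambda_ring_def)
  have "F $ n = P $ n"
  proof (rule euler_unique[OF rat_monoid_algebra_torsion_free])
    show "fps_X * fps_deriv F = F * - Abs_fps (\<lambda>m. adams lam m x)"
      unfolding F_def by (rule adams_euler[of lam, OF lam0])
    show "fps_X * fps_deriv P = P * (\<Sum>k\<in>K. L k)"
      unfolding P_def
    proof (rule euler_prod)
      fix k assume "k \<in> K"
      have "of_nat (Suc j) * c k (Suc j) = - (t k - of_nat j) * c k j" for j
        using binom_Suc[of j "t k"] unfolding c_def power_Suc
        by (metis (no_types, lifting) mult.left_commute mult_minus1 mult_minus_left)
      thus "fps_X * fps_deriv (dilated_series k (c k)) = dilated_series k (c k) * L k"
        unfolding L_def using K(3)[OF \<open>k \<in> K\<close>] by (rule euler_dilated_binomial_series[rotated])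
    qed
    have "(\<Prod>k\<in>A. dilated_series k (c k)) $ 0 = 1" for A
      by (induction A rule: infinite_finite_induct)
         (auto simp: dilated_series_def c_def binom_0)
    hence "P $ 0 = 1" by (simp add: P_def)
    thus "F $ 0 = P $ 0" using lam0 by (simp add: F_def lambda_neg_series_def)
    show "(- Abs_fps (\<lambda>m. adams lam m x)) $ 0 = 0" by (simp add: adams_def)
    fix m assume "m \<le> n"
    show "(- Abs_fps (\<lambda>m. adams lam m x)) $ m = (\<Sum>k\<in>K. L k) $ m"
    proof (cases "m = 0")
      case False
      hence "{k. k dvd S_part S m} = {k \<in> K. k dvd m}"
        using assms \<open>m \<le> n\<close> by (auto simp: dvd_S_part_iff K_def dest: dvd_imp_le)
      moreover have "adams lam m x = (\<Sum>k | k dvd S_part S m. of_nat k * t k)"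
      proof -
        have "k > 0" if "k dvd S_part S m" for k
          using that S_part_pos[of S m] by (auto intro: Nat.gr0I)
        hence "(\<Sum>k | k dvd S_part S m. of_nat k * t k) = adams lam (S_part S m) x"
          by (simp add: t_def of_nat_mult_tau moebius_inversion[OF S_part_pos, where f = "\<lambda>m. adams lam m x"])
        also have "\<dots> = adams lam m x"
          using assms False by (intro adams_S_part) auto
        finally show ?thesis by simp
      qed
      moreover have "(\<Sum>k\<in>K. L k) $ m = - (\<Sum>k | k \<in> K \<and> k dvd m. of_nat k * t k)"
        using False K(1)
        by (auto simp: fps_sum_nth L_def sum.inter_filter simp flip: sum_negf intro!: sum.cong)
      ultimately show ?thesis by simp
    qed (simp add: adams_def fps_sum_nth L_def)
  qed auto
  also have "P $ n = (\<Sum>\<nu>\<in>tuples K n. \<Prod>k\<in>K. c k (Poly_Mapping.lookup \<nu> k))"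
    unfolding P_def by (rule dilated_prod_nth[OF K(1,2)])
  also have "\<dots> = (\<Sum>\<nu>\<in>tuples K n. (-1) ^ tuple_abs \<nu> * multi_binom t \<nu>)"
    using K(1) by (intro sum.cong) (auto simp: signed_multi_binom tuples_def c_def)
  \<comment> \<open>A tuple of norm \<open>n\<close> cannot have an entry at an index above \<open>n\<close>.\<close>
  also have "tuples K n = tuples S n"
  proof -
    have "k \<le> n" if "Poly_Mapping.keys \<nu> \<subseteq> S" "tuple_norm \<nu> = n" "k \<in> Poly_Mapping.keys \<nu>" for \<nu> k
    proof -
      have "k * 1 \<le> k * Poly_Mapping.lookup \<nu> k"
        using that by (intro mult_le_mono2) (simp add: in_keys_iff Suc_le_eq)
      also have "\<dots> \<le> tuple_norm \<nu>"
        unfolding tuple_norm_def using that by (intro member_le_sum) auto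
      finally show ?thesis using that by simp
    qed
    thus ?thesis by (auto simp: tuples_def K_def)
  qed
  finally show ?thesis by (simp add: F_def lambda_neg_series_def t_def[abs_def])
qed

end
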